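(* Let $n\ge1$. The map $\vartheta$ on di-sk trees with $n$ nodes is an involution on $\mathfrak{DT}_n$ that preserves the number of $\ominus$-nodes and switches the two statistics $\mathsf{top}$ and $\mathsf{rpop}$; that is, for every $T\in\mathfrak{DT}_n$: $\vartheta(T)\in\mathfrak{DT}_n$, $\vartheta(\vartheta(T))=T$, $\mathsf{omi}(\vartheta(T))=\mathsf{omi}(T)$, $\mathsf{top}(\vartheta(T))=\mathsf{rpop}(T)$ and $\mathsf{rpop}(\vartheta(T))=\mathsf{top}(T)$. In particular it gives a bijective proof of $$\sum_{T\in\mathfrak{DT}_n}t^{\mathsf{omi}(T)}x^{\mathsf{top}(T)}y^{\mathsf{rpop}(T)}=\sum_{T\in\mathfrak{DT}_n}t^{\mathsf{omi}(T)}x^{\mathsf{rpop}(T)}y^{\mathsf{top}(T)}.$$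
   Context: A binary tree is a rooted tree in which each node has at most one left child and at most one right child. A di-sk tree is a binary tree whose nodes are labeled by $\oplus$ or $\ominus$ such that no node has the same label as its right child (right chain condition). $\mathfrak{DT}_n$ is the set of di-sk trees with $n$ nodes. The preorder visits, recursively, the parent, then its left subtree, then its right subtree. The reverse preorder visits, recursively, the right subtree, then the left subtree, then the parent. For a di-sk tree $T$: $\mathsf{top}(T)$ is the number of initial $\oplus$-nodes of $T$ under the preorder (i.e. the length of the maximal initial run of $\oplus$-nodes); $\mathsf{rpop}(T)$ is the number of initial $\oplus$-nodes of $T$ under the reverse preorder; $\mathsf{omi}(T)$ is the number of $\ominus$-nodes. The map $\vartheta$: let $v_i$ be the $i$-th node of $T$ under the preorder. Then $\vartheta(T)$ is the binary tree on the nodes $v_1,\dots,v_n$, each node keeping its label $\oplus$ or $\ominus$, with root $v_n$ and such that, for $i$ from $n-1$ down to $1$: if $v_i$ has right child $v_\ell$ in $T$, then $v_i$ is the right child of $v_\ell$ in $\vartheta(T)$; otherwise $v_i$ is the left child of $v_{i+1}$ in $\vartheta(T)$. *)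

theory Defs
  imports "HOL-Library.Tree"
begin

datatype sign = Oplus | Ominus

definition left_child :: "'a tree \<Rightarrow> 'a \<Rightarrow> 'a \<Rightarrow> bool" where
  "left_child T p c \<longleftrightarrow> (\<exists>l' r' r. Node (Node l' c r') p r \<in> subtrees T)"

definition right_child :: "'a tree \<Rightarrow> 'a \<Rightarrow> 'a \<Rightarrow> bool" where
  "right_child T p c \<longleftrightarrow> (\<exists>l l' r'. Node l p (Node l' c r') \<in> subtrees T)"

definition di_sk :: "sign tree \<Rightarrow> bool" where
  "di_sk T \<longleftrightarrow> (\<forall>a b. right_child T a b \<longrightarrow> a \<noteq> b)"

definition DT :: "nat \<Rightarrow> sign tree set" where
  "DT n = {T. size T = n \<and> di_sk T}"

fun reverse_preorder :: "'a tree \<Rightarrow> 'a list" where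
  "reverse_preorder Leaf = []"
| "reverse_preorder (Node l a r) = reverse_preorder r @ reverse_preorder l @ [a]"

definition initial_oplus :: "sign list \<Rightarrow> nat" where
  "initial_oplus xs = length (takeWhile (\<lambda>a. a = Oplus) xs)"

definition top_stat :: "sign tree \<Rightarrow> nat" where
  "top_stat T = initial_oplus (preorder T)"

definition rpop_stat :: "sign tree \<Rightarrow> nat" where
  "rpop_stat T = initial_oplus (reverse_preorder T)"

definition omi_stat :: "sign tree \<Rightarrow> nat" where
  "omi_stat T = count_list (preorder T) Ominus"

text \<open>
  To speak about the nodes of a tree rather than about their labels, the i-th node in preorder
  (counting from k) is represented by the pair of i and its label.
\<close>

fun number_from :: "nat \<Rightarrow> 'a tree \<Rightarrow> (nat \<times> 'a) tree" where
  "number_from k Leaf = Leaf"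
| "number_from k (Node l a r) =
     Node (number_from (k + 1) l) (k, a) (number_from (k + 1 + size l) r)"

lemma preorder_number_from: "preorder (number_from k T) = List.enumerate k (preorder T)"
proof (induction T arbitrary: k)
  case (Node l a r)
  have "length (preorder l) = size l"
    by (induction l) auto
  with Node show ?case
    by (simp add: enumerate_append_eq)
qed simp

definition node :: "'a tree \<Rightarrow> nat \<Rightarrow> nat \<times> 'a" where
  "node T i = (i, preorder T ! (i - 1))"

text \<open>
  The relation describing the image of \<open>T\<close> as a binary tree \<open>S\<close> on the nodes of \<open>T\<close>.
  Every node but the last one is assigned exactly one parent and one side, the parent always
  comes later in the preorder of \<open>T\<close>, and no place is assigned twice; so for nonempty \<open>T\<close>
  these conditions determine \<open>S\<close>.
\<close>

definition is_theta :: "'a tree \<Rightarrow> (nat \<times> 'a) tree \<Rightarrow> bool" where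
  "is_theta T S \<longleftrightarrow>
     (let n = size T; N = number_from 1 T; v = node T in
        distinct (preorder S) \<and> set_tree S = v ` {1..n} \<and>
        S \<noteq> Leaf \<and> value S = v n \<and>
        (\<forall>i\<in>{1..<n}.
           (\<forall>j\<in>{1..n}. right_child N (v i) (v j) \<longrightarrow> right_child S (v j) (v i)) \<and>
           ((\<nexists>j. j \<in> {1..n} \<and> right_child N (v i) (v j)) \<longrightarrow>
              left_child S (v (i + 1)) (v i))))"

definition theta :: "'a tree \<Rightarrow> 'a tree" where
  "theta T = map_tree snd (THE S. is_theta T S)"

lemma finite_DT: "finite (DT n)"
proof -
  have "finite {T :: sign tree. size T \<le> n}"
  proof (induction n)
    case (Suc n)
    let ?A = "{T :: sign tree. size T \<le> n}"
    have "UNIV = {Oplus, Ominus}"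
      using sign.exhaust by blast
    then have "finite (UNIV :: sign set)"
      by (metis finite.emptyI finite_insert)
    then have "finite (insert Leaf ((\<lambda>(l, a, r). Node l a r) ` (?A \<times> UNIV \<times> ?A)))"
      using Suc by simp
    moreover have "{T :: sign tree. size T \<le> Suc n} \<subseteq>
        insert Leaf ((\<lambda>(l, a, r). Node l a r) ` (?A \<times> UNIV \<times> ?A))"
    proof
      fix T :: "sign tree"
      assume "T \<in> {T. size T \<le> Suc n}"
      then show "T \<in> insert Leaf ((\<lambda>(l, a, r). Node l a r) ` (?A \<times> UNIV \<times> ?A))"
        by (cases T) (auto simp: image_iff)
    qed
    ultimately show ?case
      by (rule rev_finite_subset)
  qed simp
  then show ?thesis
    by (rule rev_finite_subset) (auto simp: DT_def)
qed

end

theory Submission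
  imports Defs
begin

text \<open>
  The image of \<open>T\<close> has a recursive form with two accumulators: \<open>theta_graft T L R\<close> is the image
  of \<open>T\<close>, in which the first node of \<open>T\<close> is a leaf, with \<open>L\<close> and \<open>R\<close> put below that leaf.
  The image has the right edges of \<open>T\<close>, turned around, so it inherits the right chain condition.
  Its reverse preorder is the preorder of \<open>T\<close>; as preorder and reverse preorder of a tree are reversals of
  each other, its preorder is the reverse preorder of \<open>T\<close>, and the two statistics are switched.
\<close>

section \<open>Child relations in trees with distinct labels\<close>

lemma left_child_Leaf [simp]: "\<not> left_child Leaf p c"
  by (simp add: left_child_def)

lemma right_child_Leaf [simp]: "\<not> right_child Leaf p c"
  by (simp add: right_child_def)

lemma left_child_Node [simp]:
  "left_child (Node l a r) p c \<longleftrightarrow>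
     (l \<noteq> Leaf \<and> p = a \<and> c = value l) \<or> left_child l p c \<or> left_child r p c"
proof -
  have "left_child (Node l a r) p c \<longleftrightarrow>
     (p = a \<and> (\<exists>l' r'. l = Node l' c r')) \<or> left_child l p c \<or> left_child r p c"
    by (auto simp: left_child_def)
  then show ?thesis
    by (cases l) auto
qed

lemma right_child_Node [simp]:
  "right_child (Node l a r) p c \<longleftrightarrow>
     (r \<noteq> Leaf \<and> p = a \<and> c = value r) \<or> right_child l p c \<or> right_child r p c"
proof -
  have "right_child (Node l a r) p c \<longleftrightarrow>
     (p = a \<and> (\<exists>l' r'. r = Node l' c r')) \<or> right_child l p c \<or> right_child r p c"
    by (auto simp: right_child_def)
  then show ?thesis
    by (cases r) auto
qed

lemma value_in_set_tree: "T \<noteq> Leaf \<Longrightarrow> value T \<in> set_tree T"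
  by (cases T) auto

lemma left_child_in_set_tree: "left_child T p c \<Longrightarrow> p \<in> set_tree T \<and> c \<in> set_tree T"
  by (induction T) (auto simp: value_in_set_tree)

lemma right_child_in_set_tree: "right_child T p c \<Longrightarrow> p \<in> set_tree T \<and> c \<in> set_tree T"
  by (induction T) (auto simp: value_in_set_tree)

lemma left_child_not_root: "distinct (preorder T) \<Longrightarrow> left_child T p c \<Longrightarrow> c \<noteq> value T"
  by (cases T) (auto dest: left_child_in_set_tree simp: value_in_set_tree)

lemma right_child_not_root: "distinct (preorder T) \<Longrightarrow> right_child T p c \<Longrightarrow> c \<noteq> value T"
  by (cases T) (auto dest: right_child_in_set_tree simp: value_in_set_tree)

lemma left_parent_unique:
  "distinct (preorder T) \<Longrightarrow> left_child T p c \<Longrightarrow> left_child T q c \<Longrightarrow> p = q"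
proof (induction T)
  case (Node l a r)
  then show ?case
    by (auto dest: left_child_in_set_tree left_child_not_root value_in_set_tree)
qed simp

lemma right_parent_unique:
  "distinct (preorder T) \<Longrightarrow> right_child T p c \<Longrightarrow> right_child T q c \<Longrightarrow> p = q"
proof (induction T)
  case (Node l a r)
  then show ?case
    by (auto dest: right_child_in_set_tree right_child_not_root value_in_set_tree)
qed simp

lemma left_child_not_right_child:
  "distinct (preorder T) \<Longrightarrow> left_child T p c \<Longrightarrow> \<not> right_child T q c"
proof (induction T)
  case (Node l a r)
  then show ?case
    using value_in_set_tree[of l] value_in_set_tree[of r]
    by (auto simp: disjoint_iff dest: left_child_in_set_tree right_child_in_set_tree
        left_child_not_root right_child_not_root)
qed simp

text \<open>Lets the existential child relations be read off the one subtree rooted at a given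
  label.\<close>

lemma subtree_with_root_unique:
  "distinct (preorder T) \<Longrightarrow> Node l a r \<in> subtrees T \<Longrightarrow> Node l' a r' \<in> subtrees T \<Longrightarrow>
     l = l' \<and> r = r'"
proof (induction T)
  case (Node l1 b r1)
  have "c \<in> set_tree t" if "Node u c w \<in> subtrees t" for u w t and c :: 'a
    using that by (induction t) auto
  with Node show ?case
    by (simp add: disjoint_iff) metis
qed simp

lemma left_child_value:
  assumes "distinct (preorder S)" "Node l a r \<in> subtrees S"
  shows "left_child S a c \<longleftrightarrow> l \<noteq> Leaf \<and> value l = c"
proof
  assume "left_child S a c"
  then obtain l' r' w where "Node (Node l' c r') a w \<in> subtrees S"
    by (auto simp: left_child_def)
  from subtree_with_root_unique[OF assms this]
  have "l = Node l' c r'"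
    by simp
  then show "l \<noteq> Leaf \<and> value l = c"
    by simp
next
  assume "l \<noteq> Leaf \<and> value l = c"
  then show "left_child S a c"
    using assms by (cases l) (auto simp: left_child_def)
qed

lemma right_child_value:
  assumes "distinct (preorder S)" "Node l a r \<in> subtrees S"
  shows "right_child S a c \<longleftrightarrow> r \<noteq> Leaf \<and> value r = c"
proof
  assume "right_child S a c"
  then obtain l' r' w where "Node w a (Node l' c r') \<in> subtrees S"
    by (auto simp: right_child_def)
  from subtree_with_root_unique[OF assms this]
  have "r = Node l' c r'"
    by simp
  then show "r \<noteq> Leaf \<and> value r = c"
    by simp
next
  assume "r \<noteq> Leaf \<and> value r = c"
  then show "right_child S a c"
    using assms by (cases r) (auto simp: right_child_def)
qed

lemma subtrees_trans: "s \<in> subtrees t \<Longrightarrow> t \<in> subtrees u \<Longrightarrow> s \<in> subtrees u"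
  by (induction u) auto

lemma Node_in_subtrees: "Node l a r \<in> subtrees t \<Longrightarrow> l \<in> subtrees t \<and> r \<in> subtrees t"
proof (induction t)
  case (Node l' b r')
  have "s \<in> subtrees s" for s :: "'a tree"
    by (cases s) auto
  with Node show ?case
    by auto
qed simp

text \<open>Comparison from the root downwards: at equal labels the child relations fix whether each
  child exists and which label it has.\<close>

lemma tree_eqI_children:
  assumes "distinct (preorder S)" "distinct (preorder S')"
    and "S \<noteq> Leaf" "S' \<noteq> Leaf" "value S = value S'"
    and left: "\<And>p c. left_child S p c \<longleftrightarrow> left_child S' p c"
    and right: "\<And>p c. right_child S p c \<longleftrightarrow> right_child S' p c"
  shows "S = S'"
proof -
  \<comment> \<open>The child relations are those of the whole trees, so \<open>S\<close> and
    \<open>S'\<close> stay fixed and the induction runs over pairs of their subtrees.\<close>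
  have "t = t'" if "t \<in> subtrees S" "t' \<in> subtrees S'" "t \<noteq> Leaf" "t' \<noteq> Leaf" "value t = value t'"
    for t t'
    using that
  proof (induction t arbitrary: t')
    case (Node l a r)
    then obtain l' r' where t': "t' = Node l' a r'"
      by (cases t') auto
    with Node.prems have sub: "l \<in> subtrees S" "r \<in> subtrees S" "l' \<in> subtrees S'" "r' \<in> subtrees S'"
      by (auto dest: Node_in_subtrees)
    have "(l \<noteq> Leaf \<and> value l = c) \<longleftrightarrow> (l' \<noteq> Leaf \<and> value l' = c)"
      "(r \<noteq> Leaf \<and> value r = c) \<longleftrightarrow> (r' \<noteq> Leaf \<and> value r' = c)" for c
      using Node.prems(1,2) left right assms(1,2) t'
      by (metis left_child_value, metis right_child_value)
    then show ?case
      using Node.IH sub t' by metis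
  qed simp
  from this[of S S'] assms show ?thesis
    by (cases S; cases S') auto
qed

section \<open>Numbered nodes and uniqueness of the image\<close>

lemma node_eq_nth_preorder:
  "i \<in> {1..size T} \<Longrightarrow> node T i = preorder (number_from 1 T) ! (i - 1)"
  by (auto simp: node_def preorder_number_from nth_enumerate_eq)

lemma distinct_preorder_number_from: "distinct (preorder (number_from k T))"
  by (simp add: preorder_number_from)

lemma set_tree_number_from: "set_tree (number_from 1 T) = node T ` {1..size T}"
proof -
  have "set_tree (number_from 1 T) = set (preorder (number_from 1 T))"
    by simp
  also have "\<dots> = (\<lambda>i. preorder (number_from 1 T) ! i) ` {0..<size T}"
    by (simp add: preorder_number_from set_conv_nth image_def Bex_def del: set_preorder) auto
  also have "{0..<size T} = (\<lambda>i. i - 1) ` {1..size T}"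
    by (force simp: image_iff)
  also have "(\<lambda>i. preorder (number_from 1 T) ! i) ` (\<lambda>i. i - 1) ` {1..size T} = node T ` {1..size T}"
    unfolding image_image by (intro image_cong refl) (simp only: node_eq_nth_preorder)
  finally show ?thesis .
qed

text \<open>Every node but the root has a common parent on a common side in both trees; since a node
  occupies only one place, both child relations agree.\<close>

lemma is_theta_unique:
  assumes "is_theta T S" "is_theta T S'"
  shows "S = S'"
proof -
  let ?v = "node T" and ?n = "size T"
  have S: "distinct (preorder S)" "set_tree S = ?v ` {1..?n}" "S \<noteq> Leaf" "value S = ?v ?n"
    and S': "distinct (preorder S')" "set_tree S' = ?v ` {1..?n}" "S' \<noteq> Leaf" "value S' = ?v ?n"
    using assms by (simp_all add: is_theta_def Let_def)
  have place: "(\<exists>p. right_child S p (?v i) \<and> right_child S' p (?v i)) \<or>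
      (\<exists>p. left_child S p (?v i) \<and> left_child S' p (?v i))" if "i \<in> {1..<?n}" for i
    using assms that unfolding is_theta_def Let_def by meson
  have common: "(\<exists>p. right_child S p c \<and> right_child S' p c) \<or>
      (\<exists>p. left_child S p c \<and> left_child S' p c)"
    if "c \<in> ?v ` {1..?n}" "c \<noteq> ?v ?n" for c
  proof -
    from that obtain i where i: "i \<in> {1..?n}" "c = ?v i"
      by auto
    with that have "i \<in> {1..<?n}"
      by (cases "i = ?n") auto
    with i place[of i] show ?thesis
      by simp
  qed
  \<comment> \<open>A left child is not the root, so \<open>common\<close> applies; its right
    alternative fails, as no node is both a left and a right child.\<close>
  have left: "left_child S p c \<longleftrightarrow> left_child S' p c" for p c
    using common[of c] S S'
    by (metis left_child_in_set_tree left_child_not_root left_parent_unique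
        left_child_not_right_child)
  have right: "right_child S p c \<longleftrightarrow> right_child S' p c" for p c
    using common[of c] S S'
    by (metis right_child_in_set_tree right_child_not_root right_parent_unique
        left_child_not_right_child)
  show ?thesis
    using S S' left right by (intro tree_eqI_children) auto
qed

section \<open>Recursive form of the image\<close>

text \<open>If only \<open>r\<close> is empty, the root of \<open>l\<close> follows \<open>a\<close>
  in preorder, so \<open>a\<close> goes to its left. If \<open>r\<close> is nonempty,
  \<open>a\<close> goes to the right of the root of \<open>r\<close>, and the image of
  \<open>l\<close> to the left, because its root is the last node of \<open>l\<close>, which
  directly precedes \<open>r\<close>.\<close>

fun theta_graft :: "'a tree \<Rightarrow> 'a tree \<Rightarrow> 'a tree \<Rightarrow> 'a tree" where
  "theta_graft Leaf L R = L"
| "theta_graft (Node l a r) L R =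
     (if r = Leaf then theta_graft l (Node L a R) Leaf
      else theta_graft r (theta_graft l Leaf Leaf) (Node L a R))"

lemma theta_graft_eq_Leaf_iff [simp]: "theta_graft T L R = Leaf \<longleftrightarrow> T = Leaf \<and> L = Leaf"
  by (induction T arbitrary: L R) auto

lemma map_tree_theta_graft:
  "map_tree f (theta_graft T L R) = theta_graft (map_tree f T) (map_tree f L) (map_tree f R)"
  by (induction T arbitrary: L R) auto

text \<open>\<open>Node L a R\<close> contributes \<open>R\<close>, \<open>L\<close>,
  \<open>a\<close> in this order, ahead of \<open>l\<close> and then \<open>r\<close>. The first
  equation drops \<open>R\<close>, hence the hypothesis.\<close>

lemma reverse_preorder_theta_graft:
  "T \<noteq> Leaf \<or> R = Leaf \<Longrightarrow>
     reverse_preorder (theta_graft T L R) = reverse_preorder R @ reverse_preorder L @ preorder T"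
  by (induction T arbitrary: L R) auto

text \<open>Yields both the right-edge clause of \<open>is_theta\<close> and the right chain
  condition. The last disjunct is the edge to the grafted \<open>R\<close>.\<close>

lemma right_child_theta_graft:
  "T \<noteq> Leaf \<or> R = Leaf \<Longrightarrow>
     right_child (theta_graft T L R) p c \<longleftrightarrow>
       right_child T c p \<or> right_child L p c \<or> right_child R p c \<or>
       (R \<noteq> Leaf \<and> p = value T \<and> c = value R)"
proof (induction T arbitrary: L R)
  case (Node l a r)
  then show ?case
    by (cases "l = Leaf"; cases "r = Leaf") (simp_all, blast+)
qed simp

text \<open>\<open>Node L a R\<close> is passed on whole as an accumulator, so it survives as a
  subtree.\<close>

lemma subtrees_theta_graft_root:
  "T \<noteq> Leaf \<Longrightarrow> Node L (value T) R \<in> subtrees (theta_graft T L R)"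
proof (induction T arbitrary: L R)
  case (Node l a r)
  show ?case
  proof (cases "r = Leaf")
    case True
    then show ?thesis
      using Node.IH(1)[of "Node L a R" Leaf] by (cases "l = Leaf") (auto dest: Node_in_subtrees)
  next
    case False
    then show ?thesis
      using Node_in_subtrees[OF Node.IH(2)] by simp
  qed
qed simp

lemma subtrees_theta_graft: "L \<in> subtrees (theta_graft T L R)"
proof (cases "T = Leaf")
  case True
  then show ?thesis
    by (cases L) auto
next
  case False
  then show ?thesis
    using Node_in_subtrees[OF subtrees_theta_graft_root] by blast
qed

lemma left_child_subtree: "left_child s p c \<Longrightarrow> s \<in> subtrees t \<Longrightarrow> left_child t p c"
  unfolding left_child_def by (metis subtrees_trans)

lemma preorder_eq_rev_reverse_preorder: "preorder T = rev (reverse_preorder T)"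
  by (induction T) auto

lemma hd_preorder: "T \<noteq> Leaf \<Longrightarrow> hd (preorder T) = value T"
  by (cases T) auto

lemma preorder_theta_graft_Leaf: "preorder (theta_graft T Leaf Leaf) = rev (preorder T)"
  by (simp add: preorder_eq_rev_reverse_preorder[of "theta_graft T Leaf Leaf"]
      reverse_preorder_theta_graft)

lemma value_theta_graft_Leaf:
  assumes "T \<noteq> Leaf"
  shows "value (theta_graft T Leaf Leaf) = last (preorder T)"
proof -
  have "value (theta_graft T Leaf Leaf) = hd (preorder (theta_graft T Leaf Leaf))"
    using assms by (simp add: hd_preorder)
  also have "\<dots> = hd (rev (preorder T))"
    by (simp add: preorder_theta_graft_Leaf)
  finally show ?thesis
    by (simp add: hd_rev)
qed

section \<open>Left edges between neighbours in preorder\<close>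

lemma left_child_theta_graft_root:
  assumes "T \<noteq> Leaf" "L \<noteq> Leaf"
  shows "left_child (theta_graft T L R) (value T) (value L)"
  using assms(2) by (intro left_child_subtree[OF _ subtrees_theta_graft_root[OF assms(1)]]) simp

text \<open>Locates a pair of neighbours when a preorder is split into root, left part and right
  part.\<close>

lemma consecutive_append_cases:
  assumes "us @ vs = xs @ x # y # ys"
  obtains (left) ws where "us = xs @ x # y # ws"
  | (mid) "us \<noteq> []" "vs \<noteq> []" "x = last us" "y = hd vs"
  | (right) ws where "vs = ws @ x # y # ys"
proof -
  consider zs where "us = xs @ zs" "zs @ vs = x # y # ys" | zs where "xs = us @ zs" "vs = zs @ x # y # ys"
    using assms by (auto simp: append_eq_append_conv2)
  then show thesis
  proof cases
    case (1 zs)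
    show thesis
    proof (cases zs)
      case Nil
      then show thesis using 1 right[of "[]"] by simp
    next
      case (Cons z zs')
      show thesis
      proof (cases zs')
        case Nil
        then have "us = xs @ [x]" "vs = y # ys"
          using 1 Cons by auto
        then show thesis
          by (intro mid) auto
      next
        case (Cons w ws)
        then have "us = xs @ x # y # ws"
          using 1 \<open>zs = z # zs'\<close> by auto
        then show thesis
          by (rule left)
      qed
    qed
  qed (use right in blast)
qed

text \<open>Neighbours lie both in \<open>l\<close>, both in \<open>r\<close>, or across a seam. A
  pair starting at \<open>a\<close> is settled by the first disjunct if \<open>r\<close> is
  nonempty.\<close>

lemma left_child_theta_graft_consecutive:
  assumes "preorder T = xs @ x # y # ys"
  shows "(\<exists>z. right_child T x z) \<or> left_child (theta_graft T L R) y x"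
  using assms
proof (induction T arbitrary: xs ys L R)
  case (Node l a r)
  show ?case
  proof (cases "r \<noteq> Leaf \<and> x = a")
    case False
    from Node.prems have "[a] @ (preorder l @ preorder r) = xs @ x # y # ys"
      by simp
    then show ?thesis
    proof (cases rule: consecutive_append_cases)
      \<comment> \<open>Here \<open>x\<close> is \<open>a\<close> without a right child, so
        \<open>y\<close> is the root of \<open>l\<close>, whose left accumulator is
        \<open>Node L a R\<close>.\<close>
      case mid
      with False have "r = Leaf" "l \<noteq> Leaf" "x = a" "y = value l"
        by (auto simp: hd_preorder)
      then show ?thesis
        using left_child_theta_graft_root[of l "Node L a R" Leaf] by simp
    next
      case (right ws)
      then show ?thesis
      proof (cases rule: consecutive_append_cases)
        case (left ws')
        show ?thesis
        proof (cases "r = Leaf")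
          case True
          then show ?thesis
            using Node.IH(1)[OF left] by auto
        next
          case False
          have "left_child (theta_graft r (theta_graft l Leaf Leaf) (Node L a R)) y x"
            if "left_child (theta_graft l Leaf Leaf) y x"
            using that subtrees_theta_graft by (rule left_child_subtree)
          then show ?thesis
            using False Node.IH(1)[OF left, of Leaf Leaf] by auto
        qed
      next
        \<comment> \<open>The image of \<open>l\<close> is rooted at the last node of
          \<open>l\<close> and hangs to the left of the root of \<open>r\<close>.\<close>
        case mid
        then have "l \<noteq> Leaf" "r \<noteq> Leaf"
          by auto
        then show ?thesis
          using mid left_child_theta_graft_root[of r "theta_graft l Leaf Leaf" "Node L a R"]
          by (auto simp: value_theta_graft_Leaf hd_preorder)
      next
        case (right ws')
        then have "r \<noteq> Leaf"
          by auto
        then show ?thesis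
          using Node.IH(2)[OF right] by auto
      qed
    qed simp
  qed auto
qed simp

lemma is_theta_theta_graft:
  assumes "T \<noteq> Leaf"
  shows "is_theta T (theta_graft (number_from 1 T) Leaf Leaf)"
proof -
  let ?N = "number_from 1 T" and ?v = "node T" and ?n = "size T"
  let ?S = "theta_graft ?N Leaf Leaf"
  have N: "?N \<noteq> Leaf"
    using assms by (cases T) auto
  have n: "?n \<ge> 1"
    using assms by (cases T) auto
  have len: "length (preorder ?N) = ?n"
    by (simp add: preorder_number_from)
  have "set_tree ?S = ?v ` {1..?n}"
    by (metis preorder_theta_graft_Leaf set_preorder set_rev set_tree_number_from)
  moreover have "value ?S = ?v ?n"
    using N n len by (simp add: value_theta_graft_Leaf node_eq_nth_preorder last_conv_nth)
  moreover have "left_child ?S (?v (i + 1)) (?v i)"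
    if i: "i \<in> {1..<?n}" and no: "\<nexists>j. j \<in> {1..?n} \<and> right_child ?N (?v i) (?v j)" for i
  proof -
    have split: "xs = take j xs @ xs ! j # xs ! Suc j # drop (Suc (Suc j)) xs"
      if "Suc j < length xs" for j and xs :: "(nat \<times> 'a) list"
      using that by (simp add: Cons_nth_drop_Suc)
    \<comment> \<open>Nodes are numbered from 1, list positions from 0.\<close>
    obtain j where j: "i = Suc j"
      using i by (cases i) auto
    then have "preorder ?N ! j = ?v i" "preorder ?N ! Suc j = ?v (i + 1)"
      using i node_eq_nth_preorder[of i T] node_eq_nth_preorder[of "i + 1" T] by auto
    then have "preorder ?N =
        take j (preorder ?N) @ ?v i # ?v (i + 1) # drop (Suc (Suc j)) (preorder ?N)"
      using split[of j "preorder ?N"] i j len by simp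
    \<comment> \<open>\<open>no\<close> speaks only of the nodes \<open>?v j\<close>; every right
      child in \<open>?N\<close> is one of them.\<close>
    from left_child_theta_graft_consecutive[OF this, of Leaf Leaf]
    show ?thesis
      using no right_child_in_set_tree[of ?N "?v i"]
      unfolding set_tree_number_from by blast
  qed
  ultimately show ?thesis
    using N by (simp add: is_theta_def Let_def preorder_theta_graft_Leaf distinct_preorder_number_from
        right_child_theta_graft)
qed

lemma map_tree_snd_number_from: "map_tree snd (number_from k T) = T"
  by (induction T arbitrary: k) auto

text \<open>Existence and uniqueness resolve the definite description; grafting commutes with
  relabelling, so the numbers can be erased first.\<close>

lemma theta_eq_theta_graft:
  assumes "T \<noteq> Leaf"
  shows "theta T = theta_graft T Leaf Leaf"
proof -
  have "(THE S. is_theta T S) = theta_graft (number_from 1 T) Leaf Leaf"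
    using is_theta_theta_graft[OF assms] is_theta_unique by blast
  then show ?thesis
    by (simp only: theta_def map_tree_theta_graft map_tree_snd_number_from tree.map)
qed

section \<open>The involution property\<close>

text \<open>The last node of \<open>T\<close> in preorder is a leaf and becomes the root of
  \<open>theta_graft T L R\<close>; a second graft puts \<open>A\<close> and \<open>B\<close> below
  it.\<close>

fun graft_last :: "'a tree \<Rightarrow> 'a tree \<Rightarrow> 'a tree \<Rightarrow> 'a tree" where
  "graft_last Leaf A B = Leaf"
| "graft_last (Node l a r) A B =
     (if r \<noteq> Leaf then Node l a (graft_last r A B)
      else if l \<noteq> Leaf then Node (graft_last l A B) a Leaf
      else Node A a B)"

lemma graft_last_Leaf [simp]: "graft_last T Leaf Leaf = T"
  by (induction T) auto

text \<open>
  The involution property, generalised to arbitrary accumulators so that the induction goes through: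
  it is the case where \<open>L\<close>, \<open>R\<close>, \<open>A\<close> and \<open>B\<close> are all empty.
\<close>

lemma theta_graft_theta_graft:
  "T \<noteq> Leaf \<Longrightarrow>
     theta_graft (theta_graft T L R) A B =
       (if R = Leaf then theta_graft L (graft_last T A B) Leaf
        else theta_graft R (theta_graft L Leaf Leaf) (graft_last T A B))"
proof (induction T arbitrary: L R A B)
  case (Node l a r)
  \<comment> \<open>For nonempty \<open>r\<close> the image of \<open>l\<close> is formed with empty
    accumulators and must be undone separately.\<close>
  have "theta_graft (theta_graft l Leaf Leaf) Leaf Leaf = l"
    using Node.IH(1)[of Leaf Leaf Leaf Leaf] by (cases "l = Leaf") auto
  with Node.IH show ?case
    by (cases "l = Leaf"; cases "r = Leaf") auto
qed simp

theorem mainTheorem6: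
  fixes n :: nat and t x y :: "'a :: comm_semiring_1"
  assumes "n \<ge> 1"
  shows "(\<forall>T\<in>DT n.
            theta T \<in> DT n \<and>
            theta (theta T) = T \<and>
            omi_stat (theta T) = omi_stat T \<and>
            top_stat (theta T) = rpop_stat T \<and>
            rpop_stat (theta T) = top_stat T) \<and>
         bij_betw theta (DT n) (DT n) \<and>
         (\<Sum>T\<in>DT n. t ^ omi_stat T * x ^ top_stat T * y ^ rpop_stat T) =
         (\<Sum>T\<in>DT n. t ^ omi_stat T * x ^ rpop_stat T * y ^ top_stat T)"
proof -
  have main: "theta T \<in> DT n \<and> theta (theta T) = T \<and> omi_stat (theta T) = omi_stat T \<and>
      top_stat (theta T) = rpop_stat T \<and> rpop_stat (theta T) = top_stat T" if T: "T \<in> DT n" for T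
  proof -
    from T assms have "T \<noteq> Leaf"
      by (auto simp: DT_def)
    then have th: "theta T = theta_graft T Leaf Leaf" and "theta T \<noteq> Leaf"
      by (simp_all add: theta_eq_theta_graft)
    have inv: "theta (theta T) = T"
      using \<open>T \<noteq> Leaf\<close> \<open>theta T \<noteq> Leaf\<close>
      by (simp add: theta_eq_theta_graft theta_graft_theta_graft)
    have rpre: "reverse_preorder (theta T) = preorder T"
      by (simp add: th reverse_preorder_theta_graft)
    have pre: "preorder (theta T) = rev (preorder T)"
      by (simp add: th preorder_theta_graft_Leaf)
    have "size (theta T) = size T"
      by (metis pre length_preorder length_rev)
    \<comment> \<open>Right edges are only turned around, and having different labels is
      symmetric.\<close>
    moreover have "di_sk (theta T)"
      using T by (auto simp: DT_def di_sk_def th right_child_theta_graft)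
    moreover have "omi_stat (theta T) = omi_stat T"
      by (simp add: omi_stat_def pre count_list_rev)
    moreover have "top_stat (theta T) = rpop_stat T"
      by (simp add: top_stat_def rpop_stat_def pre preorder_eq_rev_reverse_preorder[of T])
    moreover have "rpop_stat (theta T) = top_stat T"
      by (simp add: top_stat_def rpop_stat_def rpre)
    ultimately show ?thesis
      using inv T by (simp add: DT_def)
  qed
  then have bij: "bij_betw theta (DT n) (DT n)"
    by (intro bij_betw_byWitness[where f' = theta]) auto
  have "(\<Sum>T\<in>DT n. t ^ omi_stat T * x ^ top_stat T * y ^ rpop_stat T) =
      (\<Sum>T\<in>DT n. t ^ omi_stat (theta T) * x ^ top_stat (theta T) * y ^ rpop_stat (theta T))"
    using sum.reindex_bij_betw[OF bij, symmetric] .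
  also have "\<dots> = (\<Sum>T\<in>DT n. t ^ omi_stat T * x ^ rpop_stat T * y ^ top_stat T)"
    using main by (intro sum.cong) auto
  finally show ?thesis
    using main bij by blast
qed

end
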